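(* Let $G=(V,E)$ be a connected graph on $n\ge 3$ vertices. Suppose there exist an injective map $\phi:V\to\mathbb{R}^3$ and a decomposition $E=E_1\cup E_2\cup E_3$ such that the projections of $\phi$ onto the $XY$, $YZ$ and $ZX$ planes are injective on $V$ and, with edges drawn as straight-line segments between projected endpoints, form straight-line planar embeddings of $(V,E_1)$, $(V,E_2)$ and $(V,E_3)$ respectively. Then $|E|\le 9n-24$.
   Context: Projection onto the $XY$ plane maps $(x,y,z)\mapsto(x,y)$, onto the $YZ$ plane maps $(x,y,z)\mapsto(y,z)$, and onto the $ZX$ plane maps $(x,y,z)\mapsto(z,x)$. *)

theory Defs
  imports "HOL-Analysis.Analysis"
begin

definition simple_graph :: "'v set \<Rightarrow> 'v set set \<Rightarrow> bool" where
  "simple_graph V E \<longleftrightarrow> finite V \<and> E \<subseteq> {{u, v} |u v. u \<in> V \<and> v \<in> V \<and> u \<noteq> v}"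

definition connected_graph :: "'v set \<Rightarrow> 'v set set \<Rightarrow> bool" where
  "connected_graph V E \<longleftrightarrow>
     simple_graph V E \<and> V \<noteq> {} \<and> (\<forall>u\<in>V. \<forall>v\<in>V. (u, v) \<in> {(x, y). {x, y} \<in> E}\<^sup>*)"

fun proj_XY :: "real \<times> real \<times> real \<Rightarrow> real \<times> real" where
  "proj_XY (x, y, z) = (x, y)"

fun proj_YZ :: "real \<times> real \<times> real \<Rightarrow> real \<times> real" where
  "proj_YZ (x, y, z) = (y, z)"

fun proj_ZX :: "real \<times> real \<times> real \<Rightarrow> real \<times> real" where
  "proj_ZX (x, y, z) = (z, x)"

definition straight_line_planar_embedding ::
    "'v set \<Rightarrow> 'v set set \<Rightarrow> ('v \<Rightarrow> real \<times> real) \<Rightarrow> bool" where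
  "straight_line_planar_embedding V F p \<longleftrightarrow>
     inj_on p V \<and>
     (\<forall>u v. {u, v} \<in> F \<longrightarrow>
        (\<forall>w\<in>V. p w \<in> closed_segment (p u) (p v) \<longrightarrow> w \<in> {u, v})) \<and>
     (\<forall>u v x y. {u, v} \<in> F \<longrightarrow> {x, y} \<in> F \<longrightarrow> {u, v} \<noteq> {x, y} \<longrightarrow>
        closed_segment (p u) (p v) \<inter> closed_segment (p x) (p y) \<subseteq> p ` ({u, v} \<inter> {x, y}))"

end

theory Submission
  imports Defs
begin

text \<open>A small perturbation makes all \<open>x\<close>-coordinates distinct, and likewise for \<open>y\<close> and \<open>z\<close>. A straight-line
  plane graph on \<open>n \<ge> 3\<close> such points has at most \<open>3n - 6\<close> edges, and at most \<open>3n - 7\<close> if it does not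
  contain the edge joining the leftmost to the rightmost point: either that edge can be added, or
  the convex hull is not a triangle. The segment joining the two leftmost points crosses nothing, so
  it can be added to the graph in both projections that share the \<open>x\<close>-axis, and so can the one
  joining the two rightmost points. After these additions any two of the three edge sets have two
  edges in common, and three edges if both have \<open>3n - 6\<close> elements, since then they also share the
  edge from the leftmost to the rightmost point. Inclusion-exclusion shows that at least \<open>6\<close> of the
  \<open>3(3n - 6)\<close> edges are lost.\<close>

section \<open>Noncrossing drawings: adding edges and perturbing vertices\<close>

text \<open>Singletons act as degenerate edges, so edges are also kept away from vertices. Only
  disjoint pairs are constrained, which makes the condition stable under small perturbations of a
  finite graph; edges with a common endpoint are treated later through slopes.\<close>

definition noncrossing :: "'v set \<Rightarrow> 'v set set \<Rightarrow> ('v \<Rightarrow> real \<times> real) \<Rightarrow> bool" where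
  "noncrossing V F p \<longleftrightarrow>
     (\<forall>e\<in>F. \<forall>f\<in>F \<union> (\<lambda>w. {w}) ` V. e \<inter> f = {} \<longrightarrow>
        convex hull (p ` e) \<inter> convex hull (p ` f) = {})"

lemma noncrossingD:
  assumes "noncrossing V F p" "e \<in> F" "f \<in> F \<or> (\<exists>w\<in>V. f = {w})" "e \<inter> f = {}"
  shows "convex hull (p ` e) \<inter> convex hull (p ` f) = {}"
  using assms unfolding noncrossing_def by blast

lemma simple_graph_edgeE:
  assumes "simple_graph V F" "e \<in> F"
  obtains u v where "e = {u, v}" "u \<in> V" "v \<in> V" "u \<noteq> v"
  using assms unfolding simple_graph_def by blast

lemma simple_graph_finite_edges:
  assumes "simple_graph V F"
  shows "finite F"
proof (rule finite_subset)
  show "F \<subseteq> Pow V" using simple_graph_edgeE[OF assms] by blast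
  show "finite (Pow V)" using assms by (simp add: simple_graph_def)
qed

lemma noncrossing_of_embedding:
  assumes G: "simple_graph V F" and p: "straight_line_planar_embedding V F p"
  shows "noncrossing V F p"
  unfolding noncrossing_def
proof (intro ballI impI)
  fix e f assume e: "e \<in> F" and f: "f \<in> F \<union> (\<lambda>w. {w}) ` V" and d: "e \<inter> f = {}"
  obtain u v where uv: "e = {u, v}" using simple_graph_edgeE[OF G e] by metis
  have he: "convex hull (p ` e) = closed_segment (p u) (p v)"
    by (simp add: uv segment_convex_hull)
  show "convex hull (p ` e) \<inter> convex hull (p ` f) = {}"
  proof (cases "f \<in> F")
    case True
    obtain x y where xy: "f = {x, y}" using simple_graph_edgeE[OF G True] by metis
    have "convex hull (p ` f) = closed_segment (p x) (p y)"
      by (simp add: xy segment_convex_hull)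
    moreover have "{u, v} \<noteq> {x, y}" using d uv xy by auto
    moreover have "{u, v} \<in> F" "{x, y} \<in> F" using e True uv xy by auto
    ultimately have "convex hull (p ` e) \<inter> convex hull (p ` f) \<subseteq> p ` ({u, v} \<inter> {x, y})"
      using p he unfolding straight_line_planar_embedding_def by metis
    then show ?thesis using d uv xy by simp
  next
    case False
    then obtain w where w: "w \<in> V" "f = {w}" using f by auto
    then have "p w \<notin> closed_segment (p u) (p v)"
      using p e uv d unfolding straight_line_planar_embedding_def by blast
    then show ?thesis using he w by simp
  qed
qed

text \<open>Swapping coordinates is linear and injective, hence commutes with convex hulls and
  intersections. Thus either axis of a drawing can serve as the horizontal one.\<close>

lemma noncrossing_swap:
  assumes "noncrossing V F (\<lambda>v. (X v, Y v))"
  shows "noncrossing V F (\<lambda>v. (Y v, X v))"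
proof -
  have lin: "linear (prod.swap :: real \<times> real \<Rightarrow> real \<times> real)"
    by (rule linearI) (auto simp: prod.swap_def)
  have "convex hull ((\<lambda>v. (Y v, X v)) ` e) = prod.swap ` (convex hull ((\<lambda>v. (X v, Y v)) ` e))" for e
    by (simp add: convex_hull_linear_image[OF lin] image_image)
  then show ?thesis
    using assms unfolding noncrossing_def
    by (simp add: image_Int[OF inj_swap, symmetric])
qed

text \<open>A line has \<open>u\<close> and \<open>v\<close> on its closed side and every other
  vertex strictly beyond, so the new edge misses all vertices and edges disjoint from it. The weak
  inequalities allow the line to pass through \<open>u\<close> or \<open>v\<close>.\<close>

lemma noncrossing_insert:
  fixes a :: "real \<times> real"
  assumes nc: "noncrossing V F p" and G: "simple_graph V F"
    and le: "a \<bullet> p u \<le> c" "a \<bullet> p v \<le> c"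
    and gt: "\<And>w. w \<in> V - {u, v} \<Longrightarrow> a \<bullet> p w > c"
  shows "noncrossing V (insert {u, v} F) p"
proof -
  have new: "convex hull (p ` {u, v}) \<inter> convex hull (p ` f) = {}"
    if f: "f \<subseteq> V" "{u, v} \<inter> f = {}" for f
  proof -
    have "convex hull (p ` {u, v}) \<subseteq> {x. a \<bullet> x \<le> c}"
      using le by (intro hull_minimal convex_halfspace_le) auto
    moreover have "convex hull (p ` f) \<subseteq> {x. a \<bullet> x > c}"
      using gt f by (intro hull_minimal convex_halfspace_gt) blast
    ultimately show ?thesis by force
  qed
  have sub: "f \<subseteq> V" if "f \<in> F \<union> (\<lambda>w. {w}) ` V" for f
    using that simple_graph_edgeE[OF G] by blast
  show ?thesis
    unfolding noncrossing_def
  proof (intro ballI impI)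
    fix e f
    assume e: "e \<in> insert {u, v} F" and f: "f \<in> insert {u, v} F \<union> (\<lambda>w. {w}) ` V"
      and d: "e \<inter> f = {}"
    consider "e = {u, v}" "f \<in> F \<union> (\<lambda>w. {w}) ` V"
      | "e \<in> F" "f = {u, v}" | "e \<in> F" "f \<in> F \<union> (\<lambda>w. {w}) ` V"
      using e f d by auto
    then show "convex hull (p ` e) \<inter> convex hull (p ` f) = {}"
    proof cases
      case 1 then show ?thesis using new[of f] sub[of f] d by simp
    next
      case 2
      then show ?thesis using new[of e] sub[of e] d by (simp add: Int_commute)
    next
      case 3 then show ?thesis using nc d unfolding noncrossing_def by blast
    qed
  qed
qed

text \<open>Disjoint convex hulls of finite sets are strictly separated by a line, which remains a
  separating line as long as the finitely many points move only a little.\<close>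

lemma eventually_noncrossing:
  assumes nc: "noncrossing V F p" and G: "simple_graph V F"
    and lim: "\<And>v. v \<in> V \<Longrightarrow> ((\<lambda>t. q t v) \<longlongrightarrow> p v) T"
  shows "eventually (\<lambda>t. noncrossing V F (q t)) T"
proof -
  have fV: "finite V" and fF: "finite F"
    using G simple_graph_finite_edges[OF G] by (auto simp: simple_graph_def)
  have sub: "f \<subseteq> V" if "f \<in> F \<union> (\<lambda>w. {w}) ` V" for f
    using that simple_graph_edgeE[OF G] by blast
  have "eventually (\<lambda>t. convex hull (q t ` e) \<inter> convex hull (q t ` f) = {}) T"
    if e: "e \<in> F" and f: "f \<in> F \<union> (\<lambda>w. {w}) ` V" and d: "e \<inter> f = {}" for e f
  proof -
    have eV: "e \<subseteq> V" and fV': "f \<subseteq> V" using sub e f by auto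
    then have fin: "finite e" "finite f" using fV finite_subset by auto
    have "e \<noteq> {}" using simple_graph_edgeE[OF G e] by blast
    moreover have "f \<noteq> {}" using simple_graph_edgeE[OF G, of f] f by blast
    moreover have "convex hull (p ` e) \<inter> convex hull (p ` f) = {}"
      using nc e f d unfolding noncrossing_def by blast
    ultimately obtain a b where ab: "\<forall>x\<in>convex hull (p ` e). a \<bullet> x < b"
        "\<forall>x\<in>convex hull (p ` f). a \<bullet> x > b"
      using separating_hyperplane_closed_compact[of "convex hull (p ` e)" "convex hull (p ` f)"] fin
      by (auto simp: finite_imp_compact_convex_hull compact_imp_closed convex_convex_hull)
    have "eventually (\<lambda>t. a \<bullet> q t v < b) T" if "v \<in> e" for v
    proof (rule order_tendstoD(2))
      show "((\<lambda>t. a \<bullet> q t v) \<longlongrightarrow> a \<bullet> p v) T" using that eV by (intro tendsto_intros lim) auto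
      show "a \<bullet> p v < b" using ab(1) that by (simp add: hull_inc)
    qed
    then have 1: "eventually (\<lambda>t. \<forall>v\<in>e. a \<bullet> q t v < b) T"
      using fin by (simp add: eventually_ball_finite)
    have "eventually (\<lambda>t. a \<bullet> q t v > b) T" if "v \<in> f" for v
    proof (rule order_tendstoD(1))
      show "((\<lambda>t. a \<bullet> q t v) \<longlongrightarrow> a \<bullet> p v) T" using that fV' by (intro tendsto_intros lim) auto
      show "a \<bullet> p v > b" using ab(2) that by (simp add: hull_inc)
    qed
    then have 2: "eventually (\<lambda>t. \<forall>v\<in>f. a \<bullet> q t v > b) T"
      using fin by (simp add: eventually_ball_finite)
    from 1 2 show ?thesis
    proof eventually_elim
      case (elim t)
      have "convex hull (q t ` e) \<subseteq> {x. a \<bullet> x < b}"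
        using elim by (intro hull_minimal convex_halfspace_lt) auto
      moreover have "convex hull (q t ` f) \<subseteq> {x. a \<bullet> x > b}"
        using elim by (intro hull_minimal convex_halfspace_gt) auto
      ultimately show ?case by force
    qed
  qed
  then have "eventually (\<lambda>t. e \<inter> f = {} \<longrightarrow> convex hull (q t ` e) \<inter> convex hull (q t ` f) = {}) T"
    if "e \<in> F" "f \<in> F \<union> (\<lambda>w. {w}) ` V" for e f
    using that by (cases "e \<inter> f = {}") auto
  then show ?thesis
    unfolding noncrossing_def using fF fV by (intro eventually_ball_finite ballI) auto
qed

text \<open>A tie between two vertices is broken by the term with \<open>t\<close> for every
  positive \<epsilon>; a nonzero difference stays nonzero near \<open>0\<close> by
  continuity.\<close>

lemma eventually_inj_on_perturb:
  fixes x :: "'v \<Rightarrow> real"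
  assumes "finite V" and t: "inj_on t V"
  shows "eventually (\<lambda>\<epsilon>. inj_on (\<lambda>v. x v + \<epsilon> * t v) V) (at_right 0)"
proof -
  have "eventually (\<lambda>\<epsilon>. u \<noteq> v \<longrightarrow> x u + \<epsilon> * t u \<noteq> x v + \<epsilon> * t v) (at_right 0)"
    if "u \<in> V" "v \<in> V" for u v
  proof (cases "x u = x v")
    case True
    have "eventually (\<lambda>\<epsilon>::real. \<epsilon> > 0) (at_right 0)" by (simp add: eventually_at_right_less)
    then show ?thesis
      by eventually_elim (use True t that in \<open>auto simp: inj_on_def\<close>)
  next
    case False
    have "((\<lambda>\<epsilon>. (x u + \<epsilon> * t u) - (x v + \<epsilon> * t v)) \<longlongrightarrow> (x u + 0 * t u) - (x v + 0 * t v)) (at_right 0)"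
      by (intro tendsto_intros)
    then have "eventually (\<lambda>\<epsilon>. (x u + \<epsilon> * t u) - (x v + \<epsilon> * t v) \<noteq> 0) (at_right 0)"
      by (rule tendsto_imp_eventually_ne) (use False in auto)
    then show ?thesis by eventually_elim auto
  qed
  then have "eventually (\<lambda>\<epsilon>. \<forall>u\<in>V. \<forall>v\<in>V. u \<noteq> v \<longrightarrow> x u + \<epsilon> * t u \<noteq> x v + \<epsilon> * t v) (at_right 0)"
    using assms(1) by (intro eventually_ball_finite ballI) auto
  then show ?thesis by eventually_elim (auto simp: inj_on_def)
qed

section \<open>Charging the edges of a plane drawing to its vertices\<close>

text \<open>Distinct abscissas make each segment the graph of an affine function over an interval,
  so incidences become comparisons of heights. \<open>D\<close> directs the edges from left to
  right.\<close>

locale plane_segments =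
  fixes V :: "'v set" and X Y :: "'v \<Rightarrow> real" and D :: "('v \<times> 'v) set"
  assumes fin: "finite V" and inj: "inj_on X V"
    and ends: "(u, v) \<in> D \<Longrightarrow> u \<in> V \<and> v \<in> V \<and> X u < X v"
begin

definition slope :: "'v \<Rightarrow> 'v \<Rightarrow> real" where
  "slope u v = (Y v - Y u) / (X v - X u)"

definition ht :: "'v \<Rightarrow> 'v \<Rightarrow> real \<Rightarrow> real" where
  "ht u v x = Y u + slope u v * (x - X u)"

lemma ht_left [simp]: "ht u v (X u) = Y u"
  by (simp add: ht_def)

lemma ht_right [simp]: "X u \<noteq> X v \<Longrightarrow> ht u v (X v) = Y v"
  by (simp add: ht_def slope_def)

lemma ht_diff_affine: "\<exists>\<alpha> \<beta>. \<forall>x. ht a b x - ht c d x = \<alpha> + \<beta> * x"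
proof -
  have "ht a b x - ht c d x = (Y a - slope a b * X a - Y c + slope c d * X c) + (slope a b - slope c d) * x" for x
    by (simp add: ht_def algebra_simps)
  then show ?thesis by blast
qed

lemma in_segment:
  assumes "X u < x" "x < X v"
  shows "(x, ht u v x) \<in> closed_segment (X u, Y u) (X v, Y v)"
proof -
  define t where "t = (x - X u) / (X v - X u)"
  have "0 \<le> t" "t \<le> 1" using assms by (auto simp: t_def field_simps)
  moreover have t: "x - X u = t * (X v - X u)" using assms by (simp add: t_def)
  moreover have "x = (1 - t) * X u + t * X v"
    using t by (simp add: algebra_simps)
  moreover have "slope u v * (x - X u) = t * (Y v - Y u)"
    by (simp add: t_def slope_def)
  then have "ht u v x = (1 - t) * Y u + t * Y v"
    by (simp add: ht_def algebra_simps)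
  ultimately show ?thesis by (auto simp: closed_segment_def)
qed

text \<open>Named, like \<open>below\<close>, after the position of the edge relative to the vertex.
  These are the vertices to which an edge can be charged from that side.\<close>

definition above :: "'v set" where
  "above = {w\<in>V. \<exists>(u, v)\<in>D. X u < X w \<and> X w < X v \<and> Y w < ht u v (X w)}"

definition below :: "'v set" where
  "below = {w\<in>V. \<exists>(u, v)\<in>D. X u < X w \<and> X w < X v \<and> ht u v (X w) < Y w}"

end

lemma affine_root:
  fixes \<alpha> \<beta> :: real
  assumes "s < t" "\<alpha> + \<beta> * s < 0" "\<alpha> + \<beta> * t > 0"
  shows "\<exists>r. s < r \<and> r < t \<and> \<alpha> + \<beta> * r = 0"
proof -
  have b: "\<beta> > 0"
    using assms by (metis add.commute add_less_cancel_left less_trans linorder_not_less mult_le_cancel_left order_less_imp_le)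
  then show ?thesis
    using assms by (intro exI[of _ "- \<alpha> / \<beta>"]) (auto simp: field_simps)
qed

lemma affine_le:
  fixes \<alpha> \<beta> :: real
  assumes "s < r" "r < t" "\<alpha> + \<beta> * s \<le> k" "\<alpha> + \<beta> * t \<le> k"
  shows "\<alpha> + \<beta> * r \<le> k"
proof (cases "\<beta> \<ge> 0")
  case True
  then have "\<beta> * r \<le> \<beta> * t" using assms by (intro mult_left_mono) auto
  then show ?thesis using assms by simp
next
  case False
  then have "\<beta> * r \<le> \<beta> * s" using assms by (intro mult_left_mono_neg) auto
  then show ?thesis using assms by simp
qed

locale plane_drawing = plane_segments V X Y D
  for V :: "'v set" and X Y :: "'v \<Rightarrow> real" and D +
  assumes vertex_off: "\<lbrakk>(u, v) \<in> D; w \<in> V; X u < X w; X w < X v\<rbrakk> \<Longrightarrow> Y w \<noteq> ht u v (X w)"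
    and disjoint_apart: "\<lbrakk>(a, b) \<in> D; (c, d) \<in> D; {a, b} \<inter> {c, d} = {};
        X a < x; x < X b; X c < x; x < X d\<rbrakk> \<Longrightarrow> ht a b x \<noteq> ht c d x"
begin

lemma X_eq: "\<lbrakk>u \<in> V; v \<in> V; X u = X v\<rbrakk> \<Longrightarrow> u = v"
  using inj by (auto simp: inj_on_def)

lemma finite_D: "finite D"
  by (rule finite_subset[of _ "V \<times> V"]) (use ends fin in auto)

text \<open>Otherwise the nearer right endpoint would lie on the other edge, against
  \<open>vertex_off\<close>.\<close>

lemma slope_eq:
  assumes "(a, b) \<in> D" "(a, d) \<in> D" "slope a b = slope a d"
  shows "b = d"
proof -
  have *: False if "(a, b) \<in> D" "(a, d) \<in> D" "slope a b = slope a d" "X b < X d" for b d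
  proof -
    have "Y b = ht a b (X b)" using ends[OF that(1)] by simp
    also have "\<dots> = ht a d (X b)" using that by (simp add: ht_def)
    finally show False using vertex_off[OF that(2), of b] ends[OF that(1)] that by auto
  qed
  have "\<not> X b < X d" "\<not> X d < X b" using * assms by metis+
  then show ?thesis using ends[OF assms(1)] ends[OF assms(2)] by (intro X_eq) auto
qed

lemma slope_eq_right:
  assumes "(a, b) \<in> D" "(c, b) \<in> D" "slope a b = slope c b"
  shows "a = c"
proof -
  have *: False if "(a, b) \<in> D" "(c, b) \<in> D" "slope a b = slope c b" "X a < X c" for a c
  proof -
    have "Y a + slope a b * (X b - X a) = Y b" "Y c + slope c b * (X b - X c) = Y b"
      using ends[OF that(1)] ends[OF that(2)] by (simp_all add: slope_def)
    then have "Y c = ht a b (X c)" using that(3) by (simp add: ht_def algebra_simps)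
    then show False using vertex_off[OF that(1), of c] ends[OF that(2)] that by auto
  qed
  have "\<not> X a < X c" "\<not> X c < X a" using * assms by metis+
  then show ?thesis using ends[OF assms(1)] ends[OF assms(2)] by (intro X_eq) auto
qed

text \<open>For edges with a common endpoint, a second common point forces equal slopes, which
  \<open>slope_eq\<close> and \<open>slope_eq_right\<close> exclude.\<close>

lemma edges_apart:
  assumes "(a, b) \<in> D" "(c, d) \<in> D" "(a, b) \<noteq> (c, d)"
    and x: "X a < x" "x < X b" "X c < x" "x < X d"
  shows "ht a b x \<noteq> ht c d x"
proof
  assume eq: "ht a b x = ht c d x"
  then consider "a = c" | "b = d" "a \<noteq> c"
    using disjoint_apart[of a b c d x] assms by fastforce
  then show False
  proof cases
    case 1
    then have "slope a b = slope a d" using eq x by (simp add: ht_def)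
    then show False using slope_eq assms 1 by blast
  next
    case 2
    have "Y a + slope a b * (X b - X a) = Y b" "Y c + slope c b * (X b - X c) = Y b"
      using x 2 by (simp_all add: slope_def)
    then have "(slope a b - slope c b) * (X b - x) = 0"
      using eq 2 by (simp add: ht_def algebra_simps)
    then have "slope a b = slope c b" using x by simp
    then show False using slope_eq_right assms 2 by blast
  qed
qed

text \<open>The height difference is affine, so a reversal of the order would produce a zero
  strictly between \<open>s\<close> and \<open>t\<close>, where \<open>edges_apart\<close>
  applies.\<close>

lemma order_preserved:
  assumes "(a, b) \<in> D" "(c, d) \<in> D" "(a, b) \<noteq> (c, d)" "s < t"
    and "X a \<le> s" "X c \<le> s" "t \<le> X b" "t \<le> X d"
    and "ht a b s < ht c d s"
  shows "ht a b t \<le> ht c d t"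
proof (rule ccontr)
  assume "\<not> ?thesis"
  moreover obtain \<alpha> \<beta> where *: "\<And>x. ht a b x - ht c d x = \<alpha> + \<beta> * x"
    using ht_diff_affine by blast
  ultimately obtain r where r: "s < r" "r < t" "\<alpha> + \<beta> * r = 0"
    using affine_root[of s t \<alpha> \<beta>] assms(4,9) *[of s] *[of t] by auto
  then show False using edges_apart[of a b c d r] assms *[of r] by auto
qed

text \<open>Followed leftwards from \<open>X w\<close>, the edge \<open>(p, q)\<close> cannot cross
  a side of the wedge. So \<open>p\<close> is a vertex of the wedge before \<open>X w\<close>, or
  \<open>p = v\<close> with a slope between two consecutive ones, or the edge is squeezed through
  \<open>v\<close> itself; all three are impossible.\<close>

lemma wedge_empty:
  assumes b: "(v, b) \<in> D" and c: "(v, c) \<in> D" and sl: "slope v c < slope v b"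
    and consec: "\<And>q. (v, q) \<in> D \<Longrightarrow> \<not> (slope v c < slope v q \<and> slope v q < slope v b)"
    and w: "X v < X w" "X w \<le> X b" "X w \<le> X c"
    and first: "\<And>u. \<lbrakk>u \<in> V; X v < X u; X u < X w\<rbrakk> \<Longrightarrow>
        \<not> (ht v c (X u) \<le> Y u \<and> Y u \<le> ht v b (X u))"
    and f: "(p, q) \<in> D" "X p < X w" "X w < X q"
  shows "\<not> (ht v c (X w) < ht p q (X w) \<and> ht p q (X w) < ht v b (X w))"
proof
  assume bt: "ht v c (X w) < ht p q (X w) \<and> ht p q (X w) < ht v b (X w)"
  then have ne: "(p, q) \<noteq> (v, c)" "(p, q) \<noteq> (v, b)" by auto
  have pV: "p \<in> V" using ends f by auto
  have vV: "v \<in> V" using ends b by auto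
  consider "X p > X v" | "p = v" | "X p < X v" using X_eq[OF pV vV] by linarith
  then show False
  proof cases
    case 1
    have "\<not> ht v b (X p) < ht p q (X p)"
      using order_preserved[of v b p q "X p" "X w"] b f ne w 1 bt by auto
    moreover have "\<not> ht p q (X p) < ht v c (X p)"
      using order_preserved[of p q v c "X p" "X w"] c f ne w 1 bt by auto
    ultimately show False using first[OF pV] 1 f by simp
  next
    case 2
    then have "slope v c * (X w - X v) < slope v q * (X w - X v)"
      "slope v q * (X w - X v) < slope v b * (X w - X v)"
      using bt by (auto simp: ht_def)
    then show False using consec[of q] f 2 w by (simp add: mult_less_cancel_right)
  next
    case 3
    \<comment> \<open>Both sides of the wedge have height \<open>Y v\<close> at \<open>X v\<close>,
      which leaves no other height for \<open>(p, q)\<close>.\<close>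
    have "Y v \<noteq> ht p q (X v)" using vertex_off[OF f(1) vV] 3 f w by simp
    moreover have "\<not> ht v b (X v) < ht p q (X v)"
      using order_preserved[of v b p q "X v" "X w"] b f ne w 3 bt by auto
    moreover have "\<not> ht p q (X v) < ht v c (X v)"
      using order_preserved[of p q v c "X v" "X w"] c f ne w 3 bt by auto
    ultimately show False by simp
  qed
qed

definition over :: "'v \<Rightarrow> 'v \<times> 'v \<Rightarrow> bool" where
  "over w e \<longleftrightarrow> e \<in> D \<and> X (fst e) < X w \<and> X w < X (snd e)"

text \<open>The edge hit first by a vertical ray going up from \<open>w\<close>, as in a trapezoidal
  decomposition.\<close>

definition next_above :: "'v \<times> 'v \<Rightarrow> 'v \<Rightarrow> bool" where
  "next_above e w \<longleftrightarrow> over w e \<and> Y w < ht (fst e) (snd e) (X w) \<and>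
     (\<forall>f. over w f \<longrightarrow> Y w < ht (fst f) (snd f) (X w) \<longrightarrow>
        ht (fst e) (snd e) (X w) \<le> ht (fst f) (snd f) (X w))"

definition next_below :: "'v \<times> 'v \<Rightarrow> 'v \<Rightarrow> bool" where
  "next_below e w \<longleftrightarrow> over w e \<and> ht (fst e) (snd e) (X w) < Y w \<and>
     (\<forall>f. over w f \<longrightarrow> ht (fst f) (snd f) (X w) < Y w \<longrightarrow>
        ht (fst f) (snd f) (X w) \<le> ht (fst e) (snd e) (X w))"

lemma over_eq:
  assumes "over w e" "over w f" "ht (fst e) (snd e) (X w) = ht (fst f) (snd f) (X w)"
  shows "e = f"
  using assms edges_apart[of "fst e" "snd e" "fst f" "snd f" "X w"]
  unfolding over_def by (metis prod.collapse)

lemma next_above_unique: "next_above e w \<Longrightarrow> next_above f w \<Longrightarrow> e = f"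
  by (rule over_eq[of w]) (auto simp: next_above_def intro: antisym)

lemma next_below_unique: "next_below e w \<Longrightarrow> next_below f w \<Longrightarrow> e = f"
  by (rule over_eq[of w]) (auto simp: next_below_def intro: antisym)

text \<open>Let \<open>(v, c)\<close> be the next lower edge out of \<open>v\<close>. By
  \<open>wedge_empty\<close> no edge passes strictly between the two at the leftmost vertex of the
  wedge, so this vertex sees \<open>(v, b)\<close> directly above it or, if it is \<open>b\<close>,
  sees \<open>(v, c)\<close> directly below it.\<close>

lemma edge_classification:
  assumes b: "(v, b) \<in> D" and nonlow: "\<exists>c. (v, c) \<in> D \<and> slope v c < slope v b"
  shows "(\<exists>w\<in>V. next_above (v, b) w) \<or> (\<exists>c. next_below (v, c) b)"
proof -
  define S where "S = {c. (v, c) \<in> D \<and> slope v c < slope v b}"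
  have "S \<subseteq> V" using ends by (auto simp: S_def)
  then have finS: "finite S" using fin finite_subset by blast
  have "S \<noteq> {}" using nonlow by (auto simp: S_def)
  then have "Max (slope v ` S) \<in> slope v ` S" using finS by simp
  then obtain c where cS: "c \<in> S" and cmax: "slope v c = Max (slope v ` S)" by auto
  have c: "(v, c) \<in> D" and sl: "slope v c < slope v b" using cS by (auto simp: S_def)
  have consec: "\<not> (slope v c < slope v q \<and> slope v q < slope v b)" if "(v, q) \<in> D" for q
  proof
    assume *: "slope v c < slope v q \<and> slope v q < slope v b"
    then have "q \<in> S" using that by (simp add: S_def)
    then have "slope v q \<le> slope v c" using cmax finS by simp
    then show False using * by simp
  qed
  have bV: "b \<in> V" "X v < X b" and cV: "c \<in> V" "X v < X c" using ends b c by auto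
  have lt: "ht v c x < ht v b x" if "X v < x" for x using sl that by (simp add: ht_def)
  \<comment> \<open>The closed wedge without its apex, cut off at the nearer of the two right
    endpoints; that endpoint makes it nonempty.\<close>
  define W where "W = {u\<in>V. X v < X u \<and> X u \<le> X b \<and> X u \<le> X c \<and>
      ht v c (X u) \<le> Y u \<and> Y u \<le> ht v b (X u)}"
  have finW: "finite W" using fin by (simp add: W_def)
  have "(if X b \<le> X c then b else c) \<in> W"
    using bV cV lt[of "X b"] lt[of "X c"] by (auto simp: W_def)
  then have "Min (X ` W) \<in> X ` W" using finW by (intro Min_in) auto
  then obtain w where wW: "w \<in> W" and wmin: "X w = Min (X ` W)" by auto
  have first: "\<not> (ht v c (X u) \<le> Y u \<and> Y u \<le> ht v b (X u))"
    if "u \<in> V" "X v < X u" "X u < X w" for u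
  proof
    assume "ht v c (X u) \<le> Y u \<and> Y u \<le> ht v b (X u)"
    then have "u \<in> W" using that wW by (auto simp: W_def)
    then have "X w \<le> X u" using wmin finW by simp
    then show False using that by simp
  qed
  have w: "w \<in> V" "X v < X w" "X w \<le> X b" "X w \<le> X c" "ht v c (X w) \<le> Y w" "Y w \<le> ht v b (X w)"
    using wW by (auto simp: W_def)
  have empty: "\<not> (ht v c (X w) < ht p q (X w) \<and> ht p q (X w) < ht v b (X w))"
    if "over w (p, q)" for p q
    using wedge_empty[OF b c sl consec w(2-4) first, of p q] that by (simp add: over_def)
  show ?thesis
  proof (cases "w = b")
    case True
    have "b \<noteq> c" using sl by auto
    then have "X w < X c" using X_eq[OF bV(1) cV(1)] w True by fastforce
    then have o: "over w (v, c)" using c w by (simp add: over_def)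
    have y: "Y w = ht v b (X w)" using True bV by simp
    have "next_below (v, c) w"
      unfolding next_below_def
    proof (intro conjI allI impI)
      show "over w (v, c)" by (rule o)
      show "ht (fst (v, c)) (snd (v, c)) (X w) < Y w" using y lt w by simp
      fix f assume f: "over w f" "ht (fst f) (snd f) (X w) < Y w"
      then show "ht (fst f) (snd f) (X w) \<le> ht (fst (v, c)) (snd (v, c)) (X w)"
        using empty[of "fst f" "snd f"] y by auto
    qed
    then show ?thesis using True by blast
  next
    case False
    then have "X w < X b" using X_eq[OF w(1) bV(1)] w by fastforce
    then have o: "over w (v, b)" using b w by (simp add: over_def)
    have y: "Y w < ht v b (X w)"
      using vertex_off[OF b w(1)] w \<open>X w < X b\<close> by simp
    have "next_above (v, b) w"
      unfolding next_above_def
    proof (intro conjI allI impI)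
      show "over w (v, b)" by (rule o)
      show "Y w < ht (fst (v, b)) (snd (v, b)) (X w)" using y by simp
      \<comment> \<open>\<open>w\<close> may be \<open>c\<close>, on the lower side of the wedge; an
        edge over \<open>w\<close> is still strictly above that side.\<close>
      fix f assume f: "over w f" "Y w < ht (fst f) (snd f) (X w)"
      then show "ht (fst (v, b)) (snd (v, b)) (X w) \<le> ht (fst f) (snd f) (X w)"
        using empty[of "fst f" "snd f"] w by auto
    qed
    then show ?thesis using w by blast
  qed
qed

text \<open>Each edge is charged either to its left endpoint \<open>v\<close>, if it is the lowest edge leaving \<open>v\<close> to the
  right, or to the leftmost vertex \<open>w\<close> in the wedge between it and the next lower edge leaving \<open>v\<close>.
  In the second case either the edge is the first one above \<open>w\<close>, or it ends in \<open>w\<close> and the first edge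
  below \<open>w\<close> starts in \<open>v\<close>; both determine the edge from \<open>w\<close>.\<close>

lemma card_edges_le:
  assumes R: "R \<in> V" "\<And>v. v \<in> V \<Longrightarrow> X v \<le> X R"
  shows "card D \<le> (card V - 1) + card above + card below"
proof -
  define D1 where "D1 = {(v, b). (v, b) \<in> D \<and> (\<forall>c. (v, c) \<in> D \<longrightarrow> slope v b \<le> slope v c)}"
  define D2 where "D2 = {e\<in>D. \<exists>w\<in>V. next_above e w}"
  define D3 where "D3 = {(v, b). (v, b) \<in> D \<and> (\<exists>c. next_below (v, c) b)}"
  have "D \<subseteq> D1 \<union> D2 \<union> D3"
    using edge_classification unfolding D1_def D2_def D3_def by (fastforce simp: not_le)
  moreover have fins: "finite D1" "finite D2" "finite D3"
    by (rule finite_subset[OF _ finite_D]; auto simp: D1_def D2_def D3_def)+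
  ultimately have "card D \<le> card (D1 \<union> D2 \<union> D3)" by (intro card_mono) auto
  also have "\<dots> \<le> card D1 + card D2 + card D3"
    by (meson card_Un_le order_trans add_right_mono)
  finally have D: "card D \<le> card D1 + card D2 + card D3" .
  \<comment> \<open>No edge starts at the rightmost vertex.\<close>
  have "card D1 \<le> card (V - {R})"
  proof (rule card_inj_on_le[of fst])
    have "b = d" if "(a, b) \<in> D1" "(a, d) \<in> D1" for a b d
    proof (rule slope_eq[of a])
      show "(a, b) \<in> D" "(a, d) \<in> D" using that by (auto simp: D1_def)
      then show "slope a b = slope a d" using that by (intro antisym) (auto simp: D1_def)
    qed
    then show "inj_on fst D1" by (auto simp: inj_on_def)
    show "fst ` D1 \<subseteq> V - {R}"
      using ends R by (force simp: D1_def)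
  qed (use fin in auto)
  then have D1: "card D1 \<le> card V - 1" using R fin by simp
  have D2: "card D2 \<le> card above"
  proof (rule card_le_if_inj_on_rel[where r = next_above])
    show "finite above" using fin by (simp add: above_def)
    show "\<exists>b. b \<in> above \<and> next_above a b" if "a \<in> D2" for a
      using that by (force simp: D2_def above_def next_above_def over_def)
  qed (rule next_above_unique)
  have D3: "card D3 \<le> card below"
  proof (rule card_le_if_inj_on_rel[where r = "\<lambda>e w. snd e = w \<and> (\<exists>c. next_below (fst e, c) w)"])
    show "finite below" using fin by (simp add: below_def)
    show "\<exists>b. b \<in> below \<and> snd a = b \<and> (\<exists>c. next_below (fst a, c) b)" if "a \<in> D3" for a
    proof -
      obtain v b c where a: "a = (v, b)" "(v, b) \<in> D" "next_below (v, c) b"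
        using \<open>a \<in> D3\<close> by (auto simp: D3_def)
      then have "b \<in> below"
        using ends[of v b] unfolding below_def next_below_def over_def by auto
      then show ?thesis using a by auto
    qed
    show "a1 = a2" if "snd a1 = b \<and> (\<exists>c. next_below (fst a1, c) b)"
      "snd a2 = b \<and> (\<exists>c. next_below (fst a2, c) b)" for a1 a2 b
      using that next_below_unique by (metis prod.collapse prod.inject)
  qed
  show ?thesis using D D1 D2 D3 by linarith
qed

end

section \<open>Vertices that receive no charge\<close>

context plane_drawing
begin

context
  fixes L R
  assumes L: "L \<in> V" "\<And>v. v \<in> V \<Longrightarrow> X L \<le> X v"
    and R: "R \<in> V" "\<And>v. v \<in> V \<Longrightarrow> X v \<le> X R"
    and LR: "L \<noteq> R"
begin

lemma X_less: "X L < X R"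
  using L R LR X_eq[of L R] by fastforce

lemma above_subset: "above \<subseteq> V - {L, R}"
  using L R ends unfolding above_def by fastforce

lemma below_subset: "below \<subseteq> V - {L, R}"
  using L R ends unfolding below_def by fastforce

text \<open>The vertex highest over the line through \<open>L\<close> and \<open>R\<close> has no edge above it.\<close>

lemma top_vertex:
  assumes "\<exists>w\<in>V - {L, R}. ht L R (X w) \<le> Y w"
  shows "\<exists>M\<in>V - {L, R}. M \<notin> above"
proof -
  define h where "h w = Y w - ht L R (X w)" for w
  have "finite (V - {L, R})" "V - {L, R} \<noteq> {}" using fin assms by auto
  then have "Max (h ` (V - {L, R})) \<in> h ` (V - {L, R})" by simp
  then obtain M where M: "M \<in> V - {L, R}" "h M = Max (h ` (V - {L, R}))"
    by (metis imageE)
  have max: "h w \<le> h M" if "w \<in> V - {L, R}" for w using M that fin by simp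
  \<comment> \<open>Some vertex lies on or over the line, so \<open>L\<close> and \<open>R\<close>,
    at relative height \<open>0\<close>, do not exceed \<open>M\<close>.\<close>
  then have "0 \<le> h M" using assms by (force simp: h_def)
  moreover have "h L = 0" "h R = 0" using X_less by (auto simp: h_def)
  ultimately have max': "h w \<le> h M" if "w \<in> V" for w using max that by (cases "w \<in> {L, R}") auto
  have "M \<notin> above"
  proof
    assume "M \<in> above"
    then obtain u v where uv: "(u, v) \<in> D" "X u < X M" "X M < X v" "Y M < ht u v (X M)"
      by (auto simp: above_def)
    obtain \<alpha> \<beta> where *: "\<And>x. ht u v x - ht L R x = \<alpha> + \<beta> * x" using ht_diff_affine by blast
    \<comment> \<open>Relative to the line an edge is affine, hence no higher than its higher
      endpoint and so no higher than \<open>M\<close>.\<close>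
    have "ht u v (X M) - ht L R (X M) \<le> h M"
      using affine_le[of "X u" "X M" "X v" \<alpha> \<beta> "h M"] uv ends[OF uv(1)] max'[of u] max'[of v]
        *[of "X u"] *[of "X v"] *[of "X M"] by (simp add: h_def)
    then show False using uv by (simp add: h_def)
  qed
  then show ?thesis using M by blast
qed

text \<open>Mirror image of \<open>top_vertex\<close>, with the sign of the relative height
  reversed.\<close>

lemma bottom_vertex:
  assumes "\<exists>w\<in>V - {L, R}. Y w \<le> ht L R (X w)"
  shows "\<exists>M\<in>V - {L, R}. M \<notin> below"
proof -
  define h where "h w = ht L R (X w) - Y w" for w
  have "finite (V - {L, R})" "V - {L, R} \<noteq> {}" using fin assms by auto
  then have "Max (h ` (V - {L, R})) \<in> h ` (V - {L, R})" by simp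
  then obtain M where M: "M \<in> V - {L, R}" "h M = Max (h ` (V - {L, R}))"
    by (metis imageE)
  have max: "h w \<le> h M" if "w \<in> V - {L, R}" for w using M that fin by simp
  then have "0 \<le> h M" using assms by (force simp: h_def)
  moreover have "h L = 0" "h R = 0" using X_less by (auto simp: h_def)
  ultimately have max': "h w \<le> h M" if "w \<in> V" for w using max that by (cases "w \<in> {L, R}") auto
  have "M \<notin> below"
  proof
    assume "M \<in> below"
    then obtain u v where uv: "(u, v) \<in> D" "X u < X M" "X M < X v" "ht u v (X M) < Y M"
      by (auto simp: below_def)
    obtain \<alpha> \<beta> where *: "\<And>x. ht L R x - ht u v x = \<alpha> + \<beta> * x" using ht_diff_affine by blast
    have "ht L R (X M) - ht u v (X M) \<le> h M"
      using affine_le[of "X u" "X M" "X v" \<alpha> \<beta> "h M"] uv ends[OF uv(1)] max'[of u] max'[of v]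
        *[of "X u"] *[of "X v"] *[of "X M"] by (simp add: h_def)
    then show False using uv by (simp add: h_def)
  qed
  then show ?thesis using M by blast
qed

text \<open>No edge extends past \<open>L\<close> or \<open>R\<close>, so neither has an edge over
  it; \<open>top_vertex\<close> supplies a third such vertex when its assumption holds.\<close>

lemma card_above_le:
  "card above + 2 + of_bool (\<exists>w\<in>V - {L, R}. ht L R (X w) \<le> Y w) \<le> card V"
proof -
  have c: "card (V - {L, R}) + 2 = card V"
    using card_Diff_subset[of "{L, R}" V] card_mono[of V "{L, R}"] fin L R LR by simp
  have f: "finite (V - {L, R})" using fin by simp
  show ?thesis
  proof (cases "\<exists>w\<in>V - {L, R}. ht L R (X w) \<le> Y w")
    case True
    then have "card above < card (V - {L, R})"
      using top_vertex above_subset f by (intro psubset_card_mono) auto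
    then show ?thesis using c True by simp
  next
    case False
    have "card above \<le> card (V - {L, R})" using above_subset f by (rule card_mono[rotated])
    then show ?thesis using c False by simp
  qed
qed

lemma card_below_le:
  "card below + 2 + of_bool (\<exists>w\<in>V - {L, R}. Y w \<le> ht L R (X w)) \<le> card V"
proof -
  have c: "card (V - {L, R}) + 2 = card V"
    using card_Diff_subset[of "{L, R}" V] card_mono[of V "{L, R}"] fin L R LR by simp
  have f: "finite (V - {L, R})" using fin by simp
  show ?thesis
  proof (cases "\<exists>w\<in>V - {L, R}. Y w \<le> ht L R (X w)")
    case True
    then have "card below < card (V - {L, R})"
      using bottom_vertex below_subset f by (intro psubset_card_mono) auto
    then show ?thesis using c True by simp
  next
    case False
    have "card below \<le> card (V - {L, R})" using below_subset f by (rule card_mono[rotated])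
    then show ?thesis using c False by simp
  qed
qed

text \<open>With \<open>n = card V\<close> the three kinds of charges give
  \<open>(n - 1) + (n - 2) + (n - 2)\<close>, less one for each side of the line that holds a
  further vertex; a vertex on the line counts for both sides.\<close>

lemma card_edges_bound:
  "card D + 5 + of_bool (\<exists>w\<in>V - {L, R}. ht L R (X w) \<le> Y w)
     + of_bool (\<exists>w\<in>V - {L, R}. Y w \<le> ht L R (X w)) \<le> 3 * card V"
proof -
  have "card V \<ge> 1" using fin L by (metis One_nat_def Suc_leI card_gt_0_iff empty_iff)
  moreover have "card D \<le> (card V - 1) + card above + card below"
    using R by (rule card_edges_le)
  ultimately show ?thesis using card_above_le card_below_le by linarith
qed

end

end

section \<open>Edge bounds for noncrossing graphs and edges between extreme vertices\<close>

lemma plane_drawing_of_noncrossing: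
  assumes nc: "noncrossing V F (\<lambda>v. (X v, Y v))" and G: "simple_graph V F" and inj: "inj_on X V"
  shows "plane_drawing V X Y {(u, v). {u, v} \<in> F \<and> X u < X v}"
proof -
  let ?D = "{(u, v). {u, v} \<in> F \<and> X u < X v}"
  let ?p = "\<lambda>v. (X v, Y v)"
  have V: "u \<in> V \<and> v \<in> V" if "{u, v} \<in> F" for u v
    using simple_graph_edgeE[OF G that] by (metis doubleton_eq_iff)
  interpret plane_segments V X Y ?D
    using G inj V by unfold_locales (auto simp: simple_graph_def)
  have hull: "(x, ht u v x) \<in> convex hull (?p ` {u, v})" if "X u < x" "x < X v" for u v x
    using in_segment[OF that] by (simp add: segment_convex_hull)
  show ?thesis
  proof unfold_locales
    fix u v w assume *: "(u, v) \<in> ?D" "w \<in> V" "X u < X w" "X w < X v"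
    then have "{u, v} \<inter> {w} = {}" by auto
    then have "convex hull (?p ` {u, v}) \<inter> convex hull (?p ` {w}) = {}"
      using noncrossingD[OF nc, of "{u, v}" "{w}"] * by simp
    then show "Y w \<noteq> ht u v (X w)" using hull[of u "X w" v] * by auto
  next
    fix a b c d x
    assume *: "(a, b) \<in> ?D" "(c, d) \<in> ?D" "{a, b} \<inter> {c, d} = {}"
      "X a < x" "x < X b" "X c < x" "x < X d"
    then have "convex hull (?p ` {a, b}) \<inter> convex hull (?p ` {c, d}) = {}"
      using noncrossingD[OF nc, of "{a, b}" "{c, d}"] by blast
    then show "ht a b x \<noteq> ht c d x" using hull[of a x b] hull[of c x d] * by auto
  qed
qed

lemma card_oriented_edges:
  fixes X :: "'v \<Rightarrow> real"
  assumes G: "simple_graph V F" and inj: "inj_on X V"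
  shows "card {(u, v). {u, v} \<in> F \<and> X u < X v} = card F"
proof (rule bij_betw_same_card[where f = "\<lambda>(u, v). {u, v}"], rule bij_betw_imageI)
  show "inj_on (\<lambda>(u, v). {u, v}) {(u, v). {u, v} \<in> F \<and> X u < X v}"
    by (auto simp: inj_on_def doubleton_eq_iff)
  show "(\<lambda>(u, v). {u, v}) ` {(u, v). {u, v} \<in> F \<and> X u < X v} = F"
  proof (intro equalityI subsetI)
    fix e assume e: "e \<in> F"
    obtain u v where uv: "e = {u, v}" "u \<in> V" "v \<in> V" "u \<noteq> v" using simple_graph_edgeE[OF G e] .
    then have "X u \<noteq> X v" using inj by (auto simp: inj_on_def)
    then have "X u < X v \<or> X v < X u" by auto
    then show "e \<in> (\<lambda>(u, v). {u, v}) ` {(u, v). {u, v} \<in> F \<and> X u < X v}"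
    proof
      assume "X u < X v" then show ?thesis using e uv by (intro image_eqI[of _ _ "(u, v)"]) auto
    next
      assume "X v < X u"
      then show ?thesis using e uv by (intro image_eqI[of _ _ "(v, u)"]) (auto simp: insert_commute)
    qed
  qed auto
qed

text \<open>If both sides of the line through \<open>L\<close> and \<open>R\<close> hold further
  vertices, \<open>card_edges_bound\<close> saves one edge for each. Otherwise the segment is a side
  of the convex hull; if absent it can be added, and the bound for the larger graph leaves one edge
  less for \<open>F\<close>.\<close>

lemma noncrossing_card_le:
  assumes nc: "noncrossing V F (\<lambda>v. (X v, Y v))" and G: "simple_graph V F" and inj: "inj_on X V"
    and n: "card V \<ge> 3"
    and L: "L \<in> V" "\<And>v. v \<in> V \<Longrightarrow> X L \<le> X v"
    and R: "R \<in> V" "\<And>v. v \<in> V \<Longrightarrow> X v \<le> X R"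
  shows "card F + 6 + of_bool ({L, R} \<notin> F) \<le> 3 * card V"
proof -
  have fin: "finite V" using G by (simp add: simple_graph_def)
  have third: "\<exists>w. w \<in> V - {L, R}"
  proof (rule ccontr)
    assume "\<not> ?thesis"
    then have "V \<subseteq> {L, R}" by blast
    then have "card V \<le> card {L, R}" by (intro card_mono) auto
    also have "\<dots> \<le> 2" by (cases "L = R") auto
    finally show False using n by simp
  qed
  have LR: "L \<noteq> R"
  proof
    assume "L = R"
    obtain w where w: "w \<in> V" "w \<noteq> L" using third by blast
    then have "X w = X L" using L(2) R(2) \<open>L = R\<close> by (metis antisym)
    then show False using w inj_onD[OF inj] L(1) by blast
  qed
  define s where "s = (Y R - Y L) / (X R - X L)"
  define line where "line x = Y L + s * (x - X L)" for x
  \<comment> \<open>With weak inequalities, if only one of \<open>up\<close> and \<open>dn\<close>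
    holds, all other vertices lie strictly on one side.\<close>
  define up where "up \<longleftrightarrow> (\<exists>w\<in>V - {L, R}. line (X w) \<le> Y w)"
  define dn where "dn \<longleftrightarrow> (\<exists>w\<in>V - {L, R}. Y w \<le> line (X w))"
  have ud: "up \<or> dn" using third unfolding up_def dn_def by (meson linear)
  have bound: "card F' + 5 + of_bool up + of_bool dn \<le> 3 * card V"
    if "noncrossing V F' (\<lambda>v. (X v, Y v))" "simple_graph V F'" for F'
  proof -
    interpret plane_drawing V X Y "{(u, v). {u, v} \<in> F' \<and> X u < X v}"
      using that inj by (intro plane_drawing_of_noncrossing)
    have "ht L R = line" by (simp add: fun_eq_iff ht_def slope_def line_def s_def)
    then show ?thesis
      using card_edges_bound[OF L R LR] card_oriented_edges[OF that(2) inj]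
      by (simp add: up_def dn_def)
  qed
  show ?thesis
  proof (cases "{L, R} \<in> F \<or> up \<and> dn")
    case True
    then show ?thesis using bound[OF nc G] ud by (auto split: if_splits)
  next
    case False
    then have out: "{L, R} \<notin> F" by simp
    have XLR: "X L \<noteq> X R" using LR inj L R by (auto simp: inj_on_def)
    have lineR: "line (X R) = Y R" using XLR by (simp add: line_def s_def)
    have lineL: "line (X L) = Y L" by (simp add: line_def)
    have G': "simple_graph V (insert {L, R} F)" using G L R LR by (auto simp: simple_graph_def)
    have "noncrossing V (insert {L, R} F) (\<lambda>v. (X v, Y v))"
    proof (cases dn)
      case True
      then have "\<And>w. w \<in> V - {L, R} \<Longrightarrow> Y w < line (X w)"
        using False by (auto simp: up_def not_le)
      then show ?thesis
        using lineL lineR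
        \<comment> \<open>Up to a constant the functional is the depth under the line; its value on
          the line is \<open>s * X L - Y L\<close>.\<close>
        by (intro noncrossing_insert[OF nc G, of "(s, -1)" _ "s * X L - Y L"])
          (auto simp: line_def algebra_simps)
    next
      case False
      then have "\<And>w. w \<in> V - {L, R} \<Longrightarrow> line (X w) < Y w"
        by (auto simp: dn_def not_le)
      then show ?thesis
        using lineL lineR
        by (intro noncrossing_insert[OF nc G, of "(-s, 1)" _ "Y L - s * X L"])
          (auto simp: line_def algebra_simps)
    qed
    from bound[OF this G'] show ?thesis
      using out ud simple_graph_finite_edges[OF G] by (auto split: if_splits)
  qed
qed

text \<open>This is satisfied by taking for \<open>A\<close> the pair of the two lowest and the pair of the two highest
  vertices with respect to the coordinate \<open>X\<close>, and for \<open>c\<close> the pair of the lowest and the highest one.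
  The other coordinate \<open>Y\<close> of the drawing is arbitrary.\<close>

definition extreme_edges :: "'v set \<Rightarrow> ('v \<Rightarrow> real) \<Rightarrow> 'v set set \<Rightarrow> 'v set \<Rightarrow> bool" where
  "extreme_edges V X A c \<longleftrightarrow> card A = 2 \<and> card (insert c A) = 3 \<and>
     (\<forall>F Y. simple_graph V F \<longrightarrow> noncrossing V F (\<lambda>v. (X v, Y v)) \<longrightarrow>
        simple_graph V (F \<union> A) \<and> noncrossing V (F \<union> A) (\<lambda>v. (X v, Y v)) \<and>
        card F + 6 + of_bool (c \<notin> F) \<le> 3 * card V)"

lemma extreme_edgesD:
  assumes "extreme_edges V X A c" "simple_graph V F" "noncrossing V F (\<lambda>v. (X v, Y v))"
  shows "simple_graph V (F \<union> A)" "noncrossing V (F \<union> A) (\<lambda>v. (X v, Y v))"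
    "card F + 6 + of_bool (c \<notin> F) \<le> 3 * card V"
  using assms unfolding extreme_edges_def by blast+

text \<open>A vertical line through the second leftmost vertex separates the two leftmost ones from
  the rest whatever \<open>Y\<close> is, so their edge can be inserted; likewise on the
  right.\<close>

lemma extreme_edges_exist:
  fixes X :: "'v \<Rightarrow> real"
  assumes fin: "finite V" and inj: "inj_on X V" and n: "card V \<ge> 3"
  shows "\<exists>A c. extreme_edges V X A c"
proof -
  have argmin: "\<exists>m\<in>S. \<forall>w\<in>S - {m}. Z m < Z w"
    if S: "finite S" "S \<noteq> {}" "inj_on Z S" for S and Z :: "'v \<Rightarrow> real"
  proof -
    have "Min (Z ` S) \<in> Z ` S" using S by simp
    then obtain m where m: "m \<in> S" "Z m = Min (Z ` S)" by auto
    have "Z m < Z w" if "w \<in> S - {m}" for w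
    proof -
      have "Z m \<le> Z w" using m that S by simp
      moreover have "Z m \<noteq> Z w" using that m S by (auto simp: inj_on_def)
      ultimately show ?thesis by simp
    qed
    then show ?thesis using m by blast
  qed
  have pair: "\<exists>a\<in>V. \<exists>b\<in>V. Z a < Z b \<and> (\<forall>w\<in>V - {a, b}. Z b < Z w)"
    if Z: "inj_on Z V" for Z :: "'v \<Rightarrow> real"
  proof -
    have "V \<noteq> {}" using n by auto
    then obtain a where a: "a \<in> V" "\<forall>w\<in>V - {a}. Z a < Z w" using argmin[OF fin _ Z] by blast
    have "card (V - {a}) \<noteq> 0" using a n fin by simp
    then have "V - {a} \<noteq> {}" by force
    moreover have "inj_on Z (V - {a})" using Z by (rule inj_on_subset) auto
    ultimately obtain b where "b \<in> V - {a}" "\<forall>w\<in>V - {a} - {b}. Z b < Z w"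
      using argmin[of "V - {a}" Z] fin by blast
    then show ?thesis using a by (intro bexI[of _ a] bexI[of _ b]) auto
  qed
  obtain L L' where L: "L \<in> V" "L' \<in> V" "X L < X L'" "\<forall>w\<in>V - {L, L'}. X L' < X w"
    using pair[OF inj] by blast
  have "inj_on (\<lambda>v. - X v) V" using inj by (auto simp: inj_on_def)
  then obtain R R' where R: "R \<in> V" "R' \<in> V" "X R' < X R" "\<forall>w\<in>V - {R, R'}. X w < X R'"
    using pair[of "\<lambda>v. - X v"] by auto
  have "\<exists>w. w \<in> V - {L, L'}"
  proof (rule ccontr)
    assume "\<not> ?thesis"
    then have "V \<subseteq> {L, L'}" by blast
    then have "card V \<le> card {L, L'}" by (intro card_mono) auto
    also have "\<dots> \<le> 2" by (cases "L = L'") auto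
    finally show False using n by simp
  qed
  then obtain w where w: "w \<in> V" "w \<noteq> L" "w \<noteq> L'" "X L' < X w" using L by blast
  have minL: "X L \<le> X v" if "v \<in> V" for v
  proof (cases "v \<in> {L, L'}")
    case False
    then have "X L' < X v" using L that by blast
    then show ?thesis using L by simp
  qed (use L in auto)
  have maxR: "X v \<le> X R" if "v \<in> V" for v
  proof (cases "v \<in> {R, R'}")
    case False
    then have "X v < X R'" using R that by blast
    then show ?thesis using R by simp
  qed (use R in auto)
  have "X w \<le> X R" using w(1) by (rule maxR)
  then have "X L' < X R" using w(4) by simp
  then have "L \<noteq> R" "R \<noteq> L'" using L(3) by auto
  moreover have "L \<noteq> R'"
  proof
    assume "L = R'"
    then have "L' \<in> V - {R, R'}" using L \<open>R \<noteq> L'\<close> by auto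
    then have "X L' < X R'" using R by blast
    then show False using L \<open>L = R'\<close> by simp
  qed
  \<comment> \<open>\<open>L'\<close> and \<open>R'\<close> may coincide, as they do for three
    vertices; the three pairs still differ.\<close>
  ultimately have "{L, L'} \<noteq> {R, R'}" "{L, L'} \<noteq> {L, R}" "{R, R'} \<noteq> {L, R}"
    by (auto simp: doubleton_eq_iff)
  then have card: "card {{L, L'}, {R, R'}} = 2" "card (insert {L, R} {{L, L'}, {R, R'}}) = 3"
    by auto
  have sg: "simple_graph V (insert {L, L'} F)" "simple_graph V (insert {R, R'} F)"
    if "simple_graph V F" for F
    using that L R by (auto simp: simple_graph_def)
  have "extreme_edges V X {{L, L'}, {R, R'}} {L, R}"
    unfolding extreme_edges_def
  proof (intro conjI allI impI card)
    show "simple_graph V (F \<union> {{L, L'}, {R, R'}})" if "simple_graph V F" for F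
      using sg that by (simp add: insert_commute)
    show "noncrossing V (F \<union> {{L, L'}, {R, R'}}) (\<lambda>v. (X v, Y v))"
      if G: "simple_graph V F" and nc: "noncrossing V F (\<lambda>v. (X v, Y v))" for F Y
    proof -
      have "noncrossing V (insert {R, R'} F) (\<lambda>v. (X v, Y v))"
        using R by (intro noncrossing_insert[OF nc G, of "(-1, 0)" _ "- X R'"]) auto
      then have "noncrossing V (insert {L, L'} (insert {R, R'} F)) (\<lambda>v. (X v, Y v))"
        using L by (intro noncrossing_insert[OF _ sg(2)[OF G], of _ "(1, 0)" _ "X L'"]) auto
      then show ?thesis by simp
    qed
    show "card F + 6 + of_bool ({L, R} \<notin> F) \<le> 3 * card V"
      if "simple_graph V F" "noncrossing V F (\<lambda>v. (X v, Y v))" for F Y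
      using noncrossing_card_le[OF that(2,1) inj n L(1) minL R(1) maxR] by blast
  qed
  then show ?thesis by blast
qed

section \<open>Combining the three projections\<close>

text \<open>By inclusion-exclusion the overlaps cost the sum of the pairwise intersections minus the
  triple one, hence at least the sum of any two of the former. If none, one, or at least two of the
  sets fall short of \<open>m\<close>, deficits and overlaps cost at least \<open>0 + 3 + 3\<close>,
  \<open>1 + 3 + 2\<close> or \<open>2 + 2 + 2\<close>.\<close>

lemma card_Un3_le:
  fixes m :: nat
  assumes fin: "finite F1" "finite F2" "finite F3"
    and le: "card F1 \<le> m" "card F2 \<le> m" "card F3 \<le> m"
    and I12: "card (F1 \<inter> F2) \<ge> 2" "card F1 = m \<Longrightarrow> card F2 = m \<Longrightarrow> card (F1 \<inter> F2) \<ge> 3"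
    and I23: "card (F2 \<inter> F3) \<ge> 2" "card F2 = m \<Longrightarrow> card F3 = m \<Longrightarrow> card (F2 \<inter> F3) \<ge> 3"
    and I31: "card (F3 \<inter> F1) \<ge> 2" "card F3 = m \<Longrightarrow> card F1 = m \<Longrightarrow> card (F3 \<inter> F1) \<ge> 3"
  shows "card (F1 \<union> F2 \<union> F3) + 6 \<le> 3 * m"
proof -
  define t where "t = card (F1 \<inter> F2 \<inter> F3)"
  have "card (F1 \<union> F2) + card (F1 \<inter> F2) = card F1 + card F2"
    using fin card_Un_Int[of F1 F2] by simp
  moreover have "card (F1 \<union> F2 \<union> F3) + card ((F1 \<union> F2) \<inter> F3) = card (F1 \<union> F2) + card F3"
    using fin card_Un_Int[of "F1 \<union> F2" F3] by simp
  moreover have "card ((F1 \<union> F2) \<inter> F3) + t = card (F3 \<inter> F1) + card (F2 \<inter> F3)"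
    using fin card_Un_Int[of "F3 \<inter> F1" "F2 \<inter> F3"]
    by (simp add: t_def Int_Un_distrib Int_ac)
  moreover have "t \<le> card (F1 \<inter> F2)" "t \<le> card (F2 \<inter> F3)" "t \<le> card (F3 \<inter> F1)"
    unfolding t_def using fin by (auto intro!: card_mono)
  ultimately show ?thesis
    using le I12 I23 I31 by linarith
qed

lemma three_planes_bound:
  fixes X Y Z :: "'v \<Rightarrow> real"
  assumes G: "simple_graph V E1" "simple_graph V E2" "simple_graph V E3"
    and n: "card V \<ge> 3"
    and inj: "inj_on X V" "inj_on Y V" "inj_on Z V"
    and nc: "noncrossing V E1 (\<lambda>v. (X v, Y v))" "noncrossing V E2 (\<lambda>v. (Y v, Z v))"
      "noncrossing V E3 (\<lambda>v. (Z v, X v))"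
  shows "card (E1 \<union> E2 \<union> E3) + 24 \<le> 9 * card V"
proof -
  have fin: "finite V" using G by (simp add: simple_graph_def)
  obtain A a where A: "extreme_edges V X A a" using extreme_edges_exist[OF fin inj(1) n] by blast
  obtain B b where B: "extreme_edges V Y B b" using extreme_edges_exist[OF fin inj(2) n] by blast
  obtain C c where C: "extreme_edges V Z C c" using extreme_edges_exist[OF fin inj(3) n] by blast
  have card: "card A = 2" "card (insert a A) = 3" "card B = 2" "card (insert b B) = 3"
    "card C = 2" "card (insert c C) = 3"
    using A B C by (auto simp: extreme_edges_def)
  \<comment> \<open>Each drawing receives the extreme edges of both its axes, so any two of the
    enlarged sets share those of their common axis.\<close>
  define F1 F2 F3 where "F1 = E1 \<union> A \<union> B" and "F2 = E2 \<union> B \<union> C" and "F3 = E3 \<union> C \<union> A"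
  \<comment> \<open>The edges for the first axis are added, the axes are swapped, and the edges for
    the second are added; the result stays swapped.\<close>
  have nc1: "simple_graph V F1" "noncrossing V F1 (\<lambda>v. (Y v, X v))"
    unfolding F1_def
    using extreme_edgesD[OF A G(1) nc(1)] extreme_edgesD[OF B] noncrossing_swap by blast+
  have nc2: "simple_graph V F2" "noncrossing V F2 (\<lambda>v. (Z v, Y v))"
    unfolding F2_def
    using extreme_edgesD[OF B G(2) nc(2)] extreme_edgesD[OF C] noncrossing_swap by blast+
  have nc3: "simple_graph V F3" "noncrossing V F3 (\<lambda>v. (X v, Z v))"
    unfolding F3_def
    using extreme_edgesD[OF C G(3) nc(3)] extreme_edgesD[OF A] noncrossing_swap by blast+
  have finF: "finite F1" "finite F2" "finite F3"
    using nc1 nc2 nc3 simple_graph_finite_edges by auto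
  define m where "m = 3 * card V - 6"
  have m: "m + 6 = 3 * card V" using n by (simp add: m_def)
  have 1: "card F1 + of_bool (a \<notin> F1) \<le> m" "card F1 + of_bool (b \<notin> F1) \<le> m"
    using extreme_edgesD(3)[OF A nc1(1) noncrossing_swap[OF nc1(2)]]
      extreme_edgesD(3)[OF B nc1] m by auto
  have 2: "card F2 + of_bool (b \<notin> F2) \<le> m" "card F2 + of_bool (c \<notin> F2) \<le> m"
    using extreme_edgesD(3)[OF B nc2(1) noncrossing_swap[OF nc2(2)]]
      extreme_edgesD(3)[OF C nc2] m by auto
  have 3: "card F3 + of_bool (c \<notin> F3) \<le> m" "card F3 + of_bool (a \<notin> F3) \<le> m"
    using extreme_edgesD(3)[OF C nc3(1) noncrossing_swap[OF nc3(2)]]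
      extreme_edgesD(3)[OF A nc3] m by auto
  \<comment> \<open>A set missing \<open>s\<close> has fewer than \<open>m\<close> edges, so two
    sets of size \<open>m\<close> share \<open>s\<close> besides \<open>S\<close>.\<close>
  have common: "card (F \<inter> F') \<ge> 2 \<and> (card F = m \<longrightarrow> card F' = m \<longrightarrow> card (F \<inter> F') \<ge> 3)"
    if "finite F" "card S = 2" "card (insert s S) = 3" "S \<subseteq> F" "S \<subseteq> F'"
      "card F + of_bool (s \<notin> F) \<le> m" "card F' + of_bool (s \<notin> F') \<le> m"
    for F F' S :: "'v set set" and s
  proof (intro conjI impI)
    show "card (F \<inter> F') \<ge> 2" using card_mono[of "F \<inter> F'" S] that by simp
    assume "card F = m" "card F' = m"
    then have "s \<in> F" "s \<in> F'" using that by (auto split: if_splits)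
    then show "card (F \<inter> F') \<ge> 3" using card_mono[of "F \<inter> F'" "insert s S"] that by simp
  qed
  have "card (F1 \<union> F2 \<union> F3) + 6 \<le> 3 * m"
  proof (rule card_Un3_le[OF finF])
    show "card F1 \<le> m" "card F2 \<le> m" "card F3 \<le> m" using 1 2 3 by linarith+
  qed (use common[OF finF(1) card(3,4) _ _ 1(2) 2(1)] common[OF finF(2) card(5,6) _ _ 2(2) 3(1)]
        common[OF finF(3) card(1,2) _ _ 3(2) 1(1)] in \<open>auto simp: F1_def F2_def F3_def\<close>)
  moreover have "card (E1 \<union> E2 \<union> E3) \<le> card (F1 \<union> F2 \<union> F3)"
    using finF by (intro card_mono) (auto simp: F1_def F2_def F3_def)
  \<comment> \<open>Here \<open>3 * m - 6\<close> equals \<open>9 * card V - 24\<close>.\<close>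
  ultimately show ?thesis using m by linarith
qed

theorem theorem4:
  fixes V :: "'v set" and E E1 E2 E3 :: "'v set set"
    and \<phi> :: "'v \<Rightarrow> real \<times> real \<times> real" and n :: nat
  assumes "connected_graph V E"
    and "card V = n" and "n \<ge> 3"
    and "inj_on \<phi> V"
    and "E = E1 \<union> E2 \<union> E3"
    and "inj_on (proj_XY \<circ> \<phi>) V"
    and "inj_on (proj_YZ \<circ> \<phi>) V"
    and "inj_on (proj_ZX \<circ> \<phi>) V"
    and "straight_line_planar_embedding V E1 (proj_XY \<circ> \<phi>)"
    and "straight_line_planar_embedding V E2 (proj_YZ \<circ> \<phi>)"
    and "straight_line_planar_embedding V E3 (proj_ZX \<circ> \<phi>)"
  shows "int (card E) \<le> 9 * int n - 24"
proof -
  have G: "simple_graph V E1" "simple_graph V E2" "simple_graph V E3" and fin: "finite V"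
    using assms(1,5) by (auto simp: connected_graph_def simple_graph_def)
  define x y z where "x v = fst (\<phi> v)" and "y v = fst (snd (\<phi> v))" and "z v = snd (snd (\<phi> v))" for v
  have proj: "proj_XY \<circ> \<phi> = (\<lambda>v. (x v, y v))" "proj_YZ \<circ> \<phi> = (\<lambda>v. (y v, z v))"
    "proj_ZX \<circ> \<phi> = (\<lambda>v. (z v, x v))"
  proof -
    have "proj_XY (\<phi> v) = (x v, y v)" "proj_YZ (\<phi> v) = (y v, z v)" "proj_ZX (\<phi> v) = (z v, x v)" for v
      by (cases "\<phi> v"; simp add: x_def y_def z_def)+
    then show "proj_XY \<circ> \<phi> = (\<lambda>v. (x v, y v))" "proj_YZ \<circ> \<phi> = (\<lambda>v. (y v, z v))"
      "proj_ZX \<circ> \<phi> = (\<lambda>v. (z v, x v))" by auto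
  qed
  have nc: "noncrossing V E1 (\<lambda>v. (x v, y v))" "noncrossing V E2 (\<lambda>v. (y v, z v))"
    "noncrossing V E3 (\<lambda>v. (z v, x v))"
    using assms(9-11) G by (auto simp: proj intro: noncrossing_of_embedding)
  \<comment> \<open>An injective numbering of the vertices serves as a common direction of
    perturbation for all three coordinates.\<close>
  obtain h :: "'v \<Rightarrow> nat" where "inj_on h V" using fin finite_imp_inj_to_nat_seg by metis
  then have t: "inj_on (\<lambda>v. real (h v)) V" by (auto simp: inj_on_def)
  define q where "q f \<epsilon> v = f v + \<epsilon> * real (h v)" for f :: "'v \<Rightarrow> real" and \<epsilon> :: real and v
  have lim: "((\<lambda>\<epsilon>. (q f \<epsilon> v, q g \<epsilon> v)) \<longlongrightarrow> (f v, g v)) (at_right 0)" for f g v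
  proof -
    have "((\<lambda>\<epsilon>. (q f \<epsilon> v, q g \<epsilon> v)) \<longlongrightarrow> (f v + 0 * real (h v), g v + 0 * real (h v))) (at_right 0)"
      unfolding q_def by (intro tendsto_intros)
    then show ?thesis by simp
  qed
  have ev: "eventually (\<lambda>\<epsilon>. inj_on (q f \<epsilon>) V) (at_right 0)" for f
    unfolding q_def by (rule eventually_inj_on_perturb[OF fin t])
  have evnc: "eventually (\<lambda>\<epsilon>. noncrossing V F (\<lambda>v. (q f \<epsilon> v, q g \<epsilon> v))) (at_right 0)"
    if "noncrossing V F (\<lambda>v. (f v, g v))" "simple_graph V F" for F f g
    by (rule eventually_noncrossing[OF that]) (rule lim)
  \<comment> \<open>The six conditions hold together for all small positive \<epsilon>. The bound
    does not mention \<epsilon>, and the filter is nontrivial, so the bound itself follows.\<close>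
  have "eventually (\<lambda>\<epsilon>. card E + 24 \<le> 9 * card V) (at_right (0::real))"
    using ev[of x] ev[of y] ev[of z] evnc[OF nc(1) G(1)] evnc[OF nc(2) G(2)] evnc[OF nc(3) G(3)]
  proof eventually_elim
    case (elim \<epsilon>)
    then show ?case using three_planes_bound[OF G] assms(2,3,5) by simp
  qed
  then have "card E + 24 \<le> 9 * card V" by simp
  then show ?thesis using assms(2) by linarith
qed

end
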